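(* Let $(X,d)$ be a metric space, let $f_n:X\to X$, $n\ge0$, be maps, and let $A=(a_{ij})_{N\times N}$ be a transition matrix. Assume that there exist sequences $\{V_{i,n}\}_{n=0}^\infty$, $1\le i\le N$, of nonempty compact subsets of $X$ such that every $f_n$, $n\ge0$, is continuous in $E:=\bigcup_{n=0}^{\infty}\bigcup_{i=1}^{N}V_{i,n}$ and, with $V_\alpha^{m,n}:=\bigcap_{k=0}^{m}f_n^{-k}(V_{a_k,n+k})$ for $\alpha=(a_0,a_1,\dots)\in\Sigma_N^+(A)$: - $V_\alpha^{m,n}\neq\emptyset$ for all $m,n\ge0$ and all $\alpha\in\Sigma_N^+(A)$; - for every $\alpha\in\Sigma_N^+(A)$, the diameter $d(V_\alpha^{m,n})$ converges to $0$ as $m\to\infty$ uniformly with respect to $n\ge0$. Then for every $n\ge0$ there exists a nonempty compact subset $\Lambda_n\subset\bigcup_{i=1}^N V_{i,n}$ with $f_n(\Lambda_n)=\Lambda_{n+1}$ such that $(\Sigma_N^+(A),\sigma_A)$ is topologically equi-semiconjugate to the invariant subsystem of $x_{n+1}=f_n(x_n)$ on $\{\Lambda_n\}_{n=0}^\infty$. Consequently, if $(X,d)$ is compact, then $h(f_{0,\infty},\Lambda_0)\le\log\rho(A)$.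
   Context: $f_{0,\infty}:=\{f_n\}_{n=0}^\infty$. Notation: $f_i^n:=f_{i+n-1}\circ\cdots\circ f_i$ for $n\ge1$, $f_i^0$ is the identity, and $f_i^{-n}:=(f_i^n)^{-1}$ (preimage). $d(B)$ denotes the diameter of $B\subset X$. A map is continuous in a set $S\subset X$ if its restriction to $S$ is continuous. A transition matrix is a matrix $A=(a_{ij})_{N\times N}$, $N\ge2$, with $a_{ij}\in\{0,1\}$, $\sum_{j=1}^N a_{ij}\ge1$ for all $i$ and $\sum_{i=1}^N a_{ij}\ge1$ for all $j$. $\Sigma_N^+(A):=\{s=(s_0,s_1,\dots):1\le s_j\le N,\ a_{s_js_{j+1}}=1,\ j\ge0\}$, with metric $\hat\rho(\alpha,\beta):=\sum_{i=0}^\infty \hat d(a_i,b_i)/2^i$ for $\alpha=(a_0,a_1,\dots)$, $\beta=(b_0,b_1,\dots)$, where $\hat d(a,b)=0$ if $a=b$ and $1$ otherwise. $\sigma_A:\Sigma_N^+(A)\to\Sigma_N^+(A)$, $\sigma_A((s_0,s_1,s_2,\dots)):=(s_1,s_2,\dots)$. $\rho(A):=\lim_{n\to\infty}\|A^n\|^{1/n}$, where $\|B\|$ denotes the sum of all entries of $B$. For subsets $\Lambda_n\subset X$ with $f_n(\Lambda_n)\subset\Lambda_{n+1}$ for all $n\ge0$, the system restricted to $\{\Lambda_n\}$ is called the invariant subsystem on $\{\Lambda_n\}_{n=0}^\infty$. $(\Sigma_N^+(A),\sigma_A)$ is topologically equi-semiconjugate to it if there are surjective maps $h_n:\Sigma_N^+(A)\to\Lambda_n$,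 $n\ge0$, such that $h_{n+1}\circ\sigma_A=f_n\circ h_n$ for all $n\ge0$ and $\{h_n\}$ is equi-continuous in $\Sigma_N^+(A)$: for every $\epsilon>0$ there is $\delta>0$ such that $d(h_n(\alpha),h_n(\beta))<\epsilon$ for all $n\ge0$ and all $\alpha,\beta$ with $\hat\rho(\alpha,\beta)<\delta$. Topological entropy: for compact $X$ and nonempty $Y\subset X$, $h(f_{0,\infty},Y):=\sup_{\mathcal A}\limsup_{n\to\infty}\frac1n\log\mathcal N(\mathcal A_0^n|_Y)$, the supremum over open covers $\mathcal A$ of $X$, where $\mathcal A_0^n:=\{\bigcap_{j=0}^{n-1}f_0^{-j}(A_j):A_j\in\mathcal A\}$, $\mathcal B|_Y:=\{B\cap Y:B\in\mathcal B\}$, and $\mathcal N(\cdot)$ is the minimal cardinality of a subcover. *)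

theory Defs
  imports "HOL-Analysis.Analysis"
begin

text \<open>The states \<open>1, \<dots>, N\<close> are the elements of a finite type \<open>'s\<close>, so that \<open>N = CARD('s)\<close>.\<close>

definition transition_matrix :: "real^'s^'s \<Rightarrow> bool" where
  "transition_matrix A \<longleftrightarrow>
     CARD('s) \<ge> 2 \<and>
     (\<forall>i j. A $ i $ j \<in> {0, 1}) \<and>
     (\<forall>i. (\<Sum>j\<in>UNIV. A $ i $ j) \<ge> 1) \<and>
     (\<forall>j. (\<Sum>i\<in>UNIV. A $ i $ j) \<ge> 1)"

definition subshift :: "real^'s^'s \<Rightarrow> (nat \<Rightarrow> 's) set" where
  "subshift A = {s. \<forall>j. A $ s j $ s (Suc j) = 1}"

definition shift :: "(nat \<Rightarrow> 's) \<Rightarrow> nat \<Rightarrow> 's" where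
  "shift s = (\<lambda>j. s (Suc j))"

definition symbol_dist :: "(nat \<Rightarrow> 's) \<Rightarrow> (nat \<Rightarrow> 's) \<Rightarrow> real" where
  "symbol_dist \<alpha> \<beta> = (\<Sum>i. (if \<alpha> i = \<beta> i then 0 else 1) / 2 ^ i)"

text \<open>The product \<open>*\<close> (and hence \<open>^\<close>) on type \<open>vec\<close> is componentwise, so the matrix power
  has to be the iteration of \<open>**\<close>.\<close>

definition matrix_power :: "real^'s^'s \<Rightarrow> nat \<Rightarrow> real^'s^'s" where
  "matrix_power A n = (((**) A) ^^ n) (mat 1)"

definition entry_sum :: "real^'s^'s \<Rightarrow> real" where
  "entry_sum B = (\<Sum>i\<in>UNIV. \<Sum>j\<in>UNIV. B $ i $ j)"

definition matrix_growth :: "real^'s^'s \<Rightarrow> real" where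
  "matrix_growth A = lim (\<lambda>n. root n (entry_sum (matrix_power A n)))"

text \<open>\<open>orbit_map f i n\<close> is the composition \<open>f\<^sub>i\<^sub>+\<^sub>n\<^sub>-\<^sub>1 \<circ> \<dots> \<circ> f\<^sub>i\<close> of \<open>n\<close> maps.\<close>

primrec orbit_map :: "(nat \<Rightarrow> 'a \<Rightarrow> 'a) \<Rightarrow> nat \<Rightarrow> nat \<Rightarrow> 'a \<Rightarrow> 'a" where
  "orbit_map f i 0 = id"
| "orbit_map f i (Suc n) = f (i + n) \<circ> orbit_map f i n"

definition cylinder ::
  "(nat \<Rightarrow> 'a \<Rightarrow> 'a) \<Rightarrow> ('s \<Rightarrow> nat \<Rightarrow> 'a set) \<Rightarrow> (nat \<Rightarrow> 's) \<Rightarrow> nat \<Rightarrow> nat \<Rightarrow> 'a set" where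
  "cylinder f V \<alpha> m n = (\<Inter>k\<in>{0..m}. orbit_map f n k -` V (\<alpha> k) (n + k))"

definition equi_semiconjugate ::
  "real^'s^'s \<Rightarrow> (nat \<Rightarrow> 'a::metric_space \<Rightarrow> 'a) \<Rightarrow> (nat \<Rightarrow> 'a set) \<Rightarrow> bool" where
  "equi_semiconjugate A f \<Lambda> \<longleftrightarrow>
     (\<forall>n. f n ` \<Lambda> n \<subseteq> \<Lambda> (Suc n)) \<and>
     (\<exists>h :: nat \<Rightarrow> (nat \<Rightarrow> 's) \<Rightarrow> 'a.
        (\<forall>n. h n ` subshift A = \<Lambda> n) \<and>
        (\<forall>n. \<forall>\<alpha>\<in>subshift A. h (Suc n) (shift \<alpha>) = f n (h n \<alpha>)) \<and>
        (\<forall>\<epsilon>>0. \<exists>\<delta>>0. \<forall>n. \<forall>\<alpha>\<in>subshift A. \<forall>\<beta>\<in>subshift A.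
           symbol_dist \<alpha> \<beta> < \<delta> \<longrightarrow> dist (h n \<alpha>) (h n \<beta>) < \<epsilon>))"

definition join_cover ::
  "(nat \<Rightarrow> 'a \<Rightarrow> 'a) \<Rightarrow> 'a set set \<Rightarrow> nat \<Rightarrow> 'a set set" where
  "join_cover f \<A> n = {(\<Inter>j\<in>{..<n}. orbit_map f 0 j -` B j) | B. \<forall>j<n. B j \<in> \<A>}"

definition restrict_cover :: "'a set set \<Rightarrow> 'a set \<Rightarrow> 'a set set" where
  "restrict_cover \<B> Y = {B \<inter> Y | B. B \<in> \<B>}"

text \<open>Only meaningful if a finite subcover exists. This is the case in the definition of entropy
  below when \<open>UNIV\<close> is compact, even for discontinuous maps: a finite subcover of \<open>\<A>\<close>
  induces one of each \<open>join_cover f \<A> n\<close>.\<close>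

definition min_subcover :: "'a set set \<Rightarrow> 'a set \<Rightarrow> nat" where
  "min_subcover \<B> Y = (LEAST k. \<exists>\<C>\<subseteq>\<B>. finite \<C> \<and> Y \<subseteq> \<Union>\<C> \<and> card \<C> = k)"

definition entropy_on ::
  "(nat \<Rightarrow> 'a::topological_space \<Rightarrow> 'a) \<Rightarrow> 'a set \<Rightarrow> ereal" where
  "entropy_on f Y =
     (SUP \<A>\<in>{\<A>. (\<forall>U\<in>\<A>. open U) \<and> \<Union>\<A> = UNIV}.
        limsup (\<lambda>n. ereal (ln (real (min_subcover (restrict_cover (join_cover f \<A> n) Y) Y)) / real n)))"

end

theory Submission
  imports Defs
begin

text \<open>
  A point of \<open>\<Lambda> n\<close> is coded by the sequence of sets \<open>V i k\<close> that its orbit visits: the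
  cylinders of a code \<open>\<alpha>\<close> form a decreasing sequence of nonempty compact sets whose diameters
  tend to \<open>0\<close>, so they shrink to one point \<open>h n \<alpha>\<close>. Compactness of the full shift on finitely many
  symbols turns the convergence of the diameters, which is uniform in \<open>n\<close> but not assumed uniform
  in \<open>\<alpha>\<close>, into equicontinuity of the maps \<open>h n\<close>. For the entropy bound, equicontinuity gives an \<open>M\<close>
  such that words of length \<open>n + M + 1\<close> determine an \<open>n\<close>-orbit up to the Lebesgue number of a given
  cover. The number of such words is at most the sum of the entries of \<open>A ^ (n + M)\<close>, whose
  exponential growth rate exists by Fekete's lemma and does not depend on \<open>M\<close>.
\<close>

section \<open>Fekete's lemma\<close>

lemma subadditive_mult_le:
  fixes u :: "nat \<Rightarrow> real"
  assumes sub: "\<And>m n. u (m + n) \<le> u m + u n"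
  shows "u (q * m + r) \<le> real q * u m + u r"
proof (induction q)
  case (Suc q)
  have "u (Suc q * m + r) = u (m + (q * m + r))"
    by (simp add: add.assoc)
  also have "\<dots> \<le> u m + u (q * m + r)"
    by (rule sub)
  finally show ?case
    using Suc by (simp add: algebra_simps)
qed simp

text \<open>For the upper bound, fix m with \<open>u m / real m\<close> close to the infimum and
  divide n by m with remainder: the remainder costs at most a constant, which vanishes after
  division by n. The infimum starts at 1 because \<open>u 0 / real 0\<close> is 0.\<close>

lemma fekete:
  fixes u :: "nat \<Rightarrow> real"
  assumes sub: "\<And>m n. u (m + n) \<le> u m + u n" and nonneg: "\<And>n. 0 \<le> u n"
  shows "(\<lambda>n. u n / real n) \<longlonglongrightarrow> (INF n\<in>{1..}. u n / real n)"
proof (rule order_tendstoI)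
  let ?L = "INF n\<in>{1..}. u n / real n"
  have bdd: "bdd_below ((\<lambda>n. u n / real n) ` {1..})"
    by (rule bdd_belowI2[of _ 0]) (simp add: nonneg)
  show "\<forall>\<^sub>F n in sequentially. a < u n / real n" if "a < ?L" for a
  proof (rule eventually_sequentiallyI[of 1])
    fix n :: nat assume "1 \<le> n"
    then have "?L \<le> u n / real n"
      by (intro cINF_lower[OF bdd]) simp
    with that show "a < u n / real n" by simp
  qed
  show "\<forall>\<^sub>F n in sequentially. u n / real n < b" if less: "?L < b" for b
  proof -
    obtain m where m: "1 \<le> m" "u m / real m < b"
      using less cINF_less_iff[OF _ bdd] by auto
    \<comment> \<open>By nonnegativity this sum dominates \<open>u r\<close> for every possible
      remainder r.\<close>
    define C where "C = (\<Sum>r<m. u r)"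
    have C: "u r \<le> C" if "r < m" for r
      unfolding C_def using that by (intro member_le_sum) (auto simp: nonneg)
    have bound: "u n / real n \<le> u m / real m + C / real n" if "1 \<le> n" for n
    proof -
      have "u n \<le> real (n div m) * u m + u (n mod m)"
        using subadditive_mult_le[of u "n div m" m "n mod m", OF sub] by simp
      also have "\<dots> \<le> real n / real m * u m + C"
        using m C[of "n mod m"] by (intro add_mono mult_right_mono of_nat_div_le_of_nat nonneg) auto
      finally show ?thesis
        using that m by (simp add: field_simps)
    qed
    have "(\<lambda>n. u m / real m + C / real n) \<longlonglongrightarrow> u m / real m + 0"
      by (intro tendsto_intros lim_const_over_n)
    then have "\<forall>\<^sub>F n in sequentially. u m / real m + C / real n < b"
      using m by (intro order_tendstoD) auto
    with eventually_ge_at_top[of 1] show ?thesis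
      by eventually_elim (use bound in \<open>auto intro: le_less_trans\<close>)
  qed
qed

section \<open>Words of a transition matrix\<close>

text \<open>The admissible continuations of the symbol i by n further symbols. The symbol i itself
  is not stored, so that the count compares with row i of the n-th matrix power.\<close>

primrec words :: "real^'s^'s \<Rightarrow> nat \<Rightarrow> 's \<Rightarrow> 's list set" where
  "words A 0 i = {[]}"
| "words A (Suc n) i = (\<Union>k\<in>{k. A $ i $ k = 1}. Cons k ` words A n k)"

lemma finite_words: "finite (words A n i)"
  by (induction n arbitrary: i) auto

lemma shift_in_subshift: "\<alpha> \<in> subshift A \<Longrightarrow> shift \<alpha> \<in> subshift A"
  by (simp add: subshift_def shift_def)

lemma funpow_shift: "(shift ^^ j) \<alpha> = (\<lambda>k. \<alpha> (j + k))"
  by (induction j) (auto simp: shift_def)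

lemma funpow_shift_in_subshift: "\<alpha> \<in> subshift A \<Longrightarrow> (shift ^^ j) \<alpha> \<in> subshift A"
  by (induction j) (auto simp: shift_in_subshift)

lemma map_in_words: "\<alpha> \<in> subshift A \<Longrightarrow> map (shift \<alpha>) [0..<n] \<in> words A n (\<alpha> 0)"
proof (induction n arbitrary: \<alpha>)
  case (Suc n)
  have "map (shift \<alpha>) [0..<Suc n] = \<alpha> 1 # map (shift (shift \<alpha>)) [0..<n]"
    by (simp add: map_upt_Suc shift_def del: upt_Suc)
  moreover have "map (shift (shift \<alpha>)) [0..<n] \<in> words A n (\<alpha> 1)"
    using Suc.IH[OF shift_in_subshift[OF Suc.prems]] by (simp add: shift_def)
  moreover have "A $ \<alpha> 0 $ \<alpha> 1 = 1"
    using Suc.prems by (simp add: subshift_def)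
  ultimately show ?case by auto
qed simp

section \<open>Matrix powers and the count of words\<close>

lemma matrix_power_Suc: "matrix_power A (Suc n) = A ** matrix_power A n"
  by (simp add: matrix_power_def)

lemma matrix_power_add: "matrix_power A (m + n) = matrix_power A m ** matrix_power A n"
proof (induction m)
  case 0
  show ?case by (simp add: matrix_power_def)
next
  case (Suc m)
  then show ?case by (simp add: matrix_power_Suc matrix_mul_assoc)
qed

lemma matrix_power_nonneg:
  assumes "\<And>i j. 0 \<le> A $ i $ j"
  shows "0 \<le> matrix_power A n $ i $ j"
proof (induction n arbitrary: i j)
  case 0
  show ?case by (simp add: matrix_power_def mat_def)
next
  case (Suc n)
  then show ?case
    by (auto simp: matrix_power_Suc matrix_matrix_mult_def assms intro!: sum_nonneg)
qed

text \<open>Summing over columns first leaves \<open>B $ i $ k\<close> times the k-th row sum of C,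
  which is at most the sum of all entries of C.\<close>

lemma entry_sum_mult_le:
  assumes "\<And>i j. 0 \<le> B $ i $ j" "\<And>i j. 0 \<le> C $ i $ j"
  shows "entry_sum (B ** C) \<le> entry_sum B * entry_sum C"
proof -
  have row: "(\<Sum>j\<in>UNIV. C $ k $ j) \<le> entry_sum C" for k
    unfolding entry_sum_def
    by (rule member_le_sum[of k UNIV "\<lambda>k. \<Sum>j\<in>UNIV. C $ k $ j"]) (auto intro: sum_nonneg assms)
  have "entry_sum (B ** C) = (\<Sum>i\<in>UNIV. \<Sum>k\<in>UNIV. B $ i $ k * (\<Sum>j\<in>UNIV. C $ k $ j))"
    unfolding entry_sum_def matrix_matrix_mult_def
    by (simp add: sum_distrib_left) (subst sum.swap, rule refl)
  also have "\<dots> \<le> (\<Sum>i\<in>UNIV. \<Sum>k\<in>UNIV. B $ i $ k * entry_sum C)"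
    by (intro sum_mono mult_left_mono row assms)
  also have "\<dots> = entry_sum B * entry_sum C"
    by (simp add: entry_sum_def sum_distrib_right)
  finally show ?thesis .
qed

text \<open>Entry (i, j) of the n-th power counts the admissible paths of n steps from i to j. The
  induction splits off the first step.\<close>

lemma card_words_le:
  assumes "\<And>i j. A $ i $ j \<in> {0, 1}"
  shows "real (card (words A n i)) \<le> (\<Sum>j\<in>UNIV. matrix_power A n $ i $ j)"
proof (induction n arbitrary: i)
  case 0
  show ?case by (simp add: matrix_power_def mat_def)
next
  case (Suc n)
  let ?K = "{k. A $ i $ k = 1}"
  have "card (words A (Suc n) i) \<le> (\<Sum>k\<in>?K. card (Cons k ` words A n k))"
    using card_UN_le[of ?K] by simp
  also have "\<dots> = (\<Sum>k\<in>?K. card (words A n k))"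
    by (intro sum.cong refl card_image) simp
  finally have "real (card (words A (Suc n) i)) \<le> (\<Sum>k\<in>?K. real (card (words A n k)))"
    by (metis of_nat_le_iff of_nat_sum)
  also have "\<dots> \<le> (\<Sum>k\<in>?K. \<Sum>j\<in>UNIV. matrix_power A n $ k $ j)"
    by (intro sum_mono Suc.IH)
  \<comment> \<open>As the entries are 0 or 1, summing over the successors of i is the same as
    weighting by row i of A.\<close>
  also have "\<dots> = (\<Sum>k\<in>UNIV. A $ i $ k * (\<Sum>j\<in>UNIV. matrix_power A n $ k $ j))"
    using assms by (intro sum.mono_neutral_cong_left) auto
  also have "\<dots> = (\<Sum>j\<in>UNIV. matrix_power A (Suc n) $ i $ j)"
    by (simp add: matrix_power_Suc matrix_matrix_mult_def sum_distrib_left) (rule sum.swap)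
  finally show ?case .
qed

lemma transition_matrixD:
  assumes "transition_matrix A"
  shows "A $ i $ j \<in> {0, 1}" "\<exists>j. A $ i $ j = 1" "\<exists>i. A $ i $ j = 1"
proof -
  have *: "\<exists>k. g k = 1" if "1 \<le> (\<Sum>k\<in>UNIV. g k)" "\<And>k. g k \<in> {0, 1}" for g :: "'a \<Rightarrow> real"
  proof (rule ccontr)
    assume "\<nexists>k. g k = 1"
    with that(2) have "g k = 0" for k by blast
    with that(1) show False by simp
  qed
  show A: "A $ i $ j \<in> {0, 1}" for i j
    using assms by (simp add: transition_matrix_def)
  show "\<exists>j. A $ i $ j = 1" "\<exists>i. A $ i $ j = 1"
    using assms A by (auto simp: transition_matrix_def intro!: *)
qed

lemma subshift_nonempty:
  assumes "transition_matrix A"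
  shows "subshift A \<noteq> {}"
proof -
  obtain next_symbol where "\<And>i. A $ i $ next_symbol i = 1"
    using transition_matrixD(2)[OF assms] by metis
  \<comment> \<open>Any starting symbol will do, and \<open>undefined\<close> names one.\<close>
  then have "(\<lambda>k. (next_symbol ^^ k) undefined) \<in> subshift A"
    by (simp add: subshift_def)
  then show ?thesis by blast
qed

text \<open>Each symbol has a predecessor, which can be prepended to a sequence. This is why the
  coded sets are mapped onto one another and not only into.\<close>

lemma shift_image_subshift:
  assumes "transition_matrix A"
  shows "shift ` subshift A = subshift A"
proof
  show "shift ` subshift A \<subseteq> subshift A"
    by (auto intro: shift_in_subshift)
  show "subshift A \<subseteq> shift ` subshift A"
  proof
    fix \<alpha> assume \<alpha>: "\<alpha> \<in> subshift A"
    obtain i where "A $ i $ \<alpha> 0 = 1"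
      using transition_matrixD(3)[OF assms] by blast
    with \<alpha> have "case_nat i \<alpha> \<in> subshift A"
      by (auto simp: subshift_def split: nat.split)
    moreover have "\<alpha> = shift (case_nat i \<alpha>)"
      by (simp add: shift_def)
    ultimately show "\<alpha> \<in> shift ` subshift A" by blast
  qed
qed

text \<open>The subshift is nonempty, so there is at least one word to count. The logarithms below
  are therefore nonnegative, as Fekete's lemma asks.\<close>

lemma entry_sum_matrix_power_ge_1:
  assumes "transition_matrix A"
  shows "1 \<le> entry_sum (matrix_power A n)"
proof -
  note A = transition_matrixD(1)[OF assms]
  have nonneg: "0 \<le> A $ i $ j" for i j
    using A[of i j] by auto
  obtain \<alpha> where "\<alpha> \<in> subshift A"
    using subshift_nonempty[OF assms] by blast
  then have "words A n (\<alpha> 0) \<noteq> {}"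
    using map_in_words by blast
  then have "1 \<le> real (card (words A n (\<alpha> 0)))"
    by (simp add: Suc_le_eq card_gt_0_iff finite_words)
  also have "\<dots> \<le> (\<Sum>j\<in>UNIV. matrix_power A n $ \<alpha> 0 $ j)"
    by (rule card_words_le[OF A])
  also have "\<dots> \<le> entry_sum (matrix_power A n)"
    unfolding entry_sum_def
    by (rule member_le_sum[of _ UNIV "\<lambda>i. \<Sum>j\<in>UNIV. matrix_power A n $ i $ j"])
      (auto intro!: sum_nonneg matrix_power_nonneg nonneg)
  finally show ?thesis .
qed

text \<open>The logarithms are subadditive, so Fekete's lemma gives a limit. Its exponential is the
  limit of the roots, so \<open>lim\<close> in \<open>matrix_growth\<close> denotes a genuine
  limit.\<close>

lemma ln_entry_sum_tendsto:
  assumes "transition_matrix A"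
  shows "(\<lambda>n. ln (entry_sum (matrix_power A n)) / real n) \<longlonglongrightarrow> ln (matrix_growth A)"
proof -
  let ?a = "\<lambda>n. entry_sum (matrix_power A n)"
  have pos: "0 < ?a n" for n
    using entry_sum_matrix_power_ge_1[OF assms, of n] by linarith
  have nonneg: "0 \<le> A $ i $ j" for i j
    using transition_matrixD(1)[OF assms, of i j] by auto
  have "ln (?a (m + n)) \<le> ln (?a m) + ln (?a n)" for m n
  proof -
    have "?a (m + n) \<le> ?a m * ?a n"
      unfolding matrix_power_add by (intro entry_sum_mult_le matrix_power_nonneg nonneg)
    then have "ln (?a (m + n)) \<le> ln (?a m * ?a n)"
      using pos by (simp add: mult_pos_pos)
    also have "\<dots> = ln (?a m) + ln (?a n)"
      using pos[of m] pos[of n] by (simp add: ln_mult)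
    finally show ?thesis .
  qed
  then obtain L where L: "(\<lambda>n. ln (?a n) / real n) \<longlonglongrightarrow> L"
    using fekete[of "\<lambda>n. ln (?a n)"] entry_sum_matrix_power_ge_1[OF assms] by force
  have "(\<lambda>n. root n (?a n)) \<longlonglongrightarrow> exp L"
  proof (rule Lim_transform_eventually)
    show "(\<lambda>n. exp (ln (?a n) / real n)) \<longlonglongrightarrow> exp L"
      by (intro tendsto_exp L)
    \<comment> \<open>At n = 0 the two sides are 1 and 0, so they agree only eventually.\<close>
    show "\<forall>\<^sub>F n in sequentially. exp (ln (?a n) / real n) = root n (?a n)"
      using eventually_gt_at_top[of 0]
      by eventually_elim (simp add: pos flip: ln_root)
  qed
  then have "matrix_growth A = exp L"
    unfolding matrix_growth_def by (rule limI)
  with L show ?thesis by simp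
qed

section \<open>Compactness of the full shift\<close>

text \<open>The sequences sharing a prefix with \<alpha> form an open set in the product of finite
  discrete spaces, and this product is compact by Tychonoff's theorem. The prefix length may vary
  with \<alpha>.\<close>

lemma finite_subcover_by_prefixes:
  fixes m :: "(nat \<Rightarrow> 's::finite) \<Rightarrow> nat"
  shows "\<exists>F. finite F \<and> (\<forall>\<beta>. \<exists>\<alpha>\<in>F. \<forall>k\<le>m \<alpha>. \<beta> k = \<alpha> k)"
proof -
  let ?T = "product_topology (\<lambda>_::nat. discrete_topology (UNIV :: 's set)) UNIV"
  let ?U = "\<lambda>\<alpha>. {\<beta>. \<forall>k\<le>m \<alpha>. \<beta> k = \<alpha> k}"
  have "compact_space ?T"
    by (simp add: compact_space_product_topology compact_space_discrete_topology)
  moreover have "openin ?T (?U \<alpha>)" for \<alpha>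
  proof -
    let ?X = "\<lambda>k. if k \<le> m \<alpha> then {\<alpha> k} else UNIV"
    have "openin ?T (\<Pi>\<^sub>E k\<in>UNIV. ?X k)"
      by (rule product_topology_basis) (auto intro: finite_subset[of _ "{..m \<alpha>}"])
    moreover have "(\<Pi>\<^sub>E k\<in>UNIV. ?X k) = ?U \<alpha>"
      by (auto simp: PiE_def Pi_def split: if_splits)
    ultimately show ?thesis by simp
  qed
  moreover have "topspace ?T \<subseteq> \<Union> (range ?U)"
    by auto
  ultimately obtain \<F> where "finite \<F>" "\<F> \<subseteq> range ?U" "topspace ?T \<subseteq> \<Union> \<F>"
    using compact_space_alt[THEN iffD1, rule_format, of ?T "range ?U"] by auto
  then obtain F where "finite F" "topspace ?T \<subseteq> (\<Union>\<alpha>\<in>F. ?U \<alpha>)"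
    using finite_subset_image[of \<F> ?U UNIV] by auto
  then show ?thesis by (intro exI[of _ F]) (simp add: subset_iff)
qed

lemma finite_subcover_by_prefixes_subshift:
  fixes m :: "(nat \<Rightarrow> 's::finite) \<Rightarrow> nat"
  obtains F where "finite F" "F \<subseteq> subshift A"
    "\<And>\<beta>. \<beta> \<in> subshift A \<Longrightarrow> \<exists>\<alpha>\<in>F. \<forall>k\<le>m \<alpha>. \<beta> k = \<alpha> k"
proof -
  \<comment> \<open>A sequence outside the subshift has a forbidden transition, which isolates it from the subshift.\<close>
  have "\<forall>\<alpha>. \<exists>j. \<alpha> \<notin> subshift A \<longrightarrow> A $ \<alpha> j $ \<alpha> (Suc j) \<noteq> 1"
    by (auto simp: subshift_def)
  from choice[OF this]
  obtain l where l: "\<And>\<alpha>. \<alpha> \<notin> subshift A \<Longrightarrow> A $ \<alpha> (l \<alpha>) $ \<alpha> (Suc (l \<alpha>)) \<noteq> 1"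
    by blast
  \<comment> \<open>A prefix up to index \<open>Suc (l \<alpha>)\<close> contains both ends of the
    forbidden transition.\<close>
  obtain F where F: "finite F"
      "\<And>\<beta>. \<exists>\<alpha>\<in>F. \<forall>k\<le>(if \<alpha> \<in> subshift A then m \<alpha> else Suc (l \<alpha>)). \<beta> k = \<alpha> k"
    using finite_subcover_by_prefixes[of "\<lambda>\<alpha>. if \<alpha> \<in> subshift A then m \<alpha> else Suc (l \<alpha>)"] by blast
  show ?thesis
  proof
    fix \<beta> assume \<beta>: "\<beta> \<in> subshift A"
    obtain \<alpha> where \<alpha>: "\<alpha> \<in> F" "\<forall>k\<le>(if \<alpha> \<in> subshift A then m \<alpha> else Suc (l \<alpha>)). \<beta> k = \<alpha> k"
      using F by blast
    have "\<alpha> \<in> subshift A"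
    proof (rule ccontr)
      assume "\<alpha> \<notin> subshift A"
      with l \<alpha> have "A $ \<beta> (l \<alpha>) $ \<beta> (Suc (l \<alpha>)) \<noteq> 1"
        by simp
      with \<beta> show False by (simp add: subshift_def)
    qed
    with \<alpha> show "\<exists>\<alpha>\<in>F \<inter> subshift A. \<forall>k\<le>m \<alpha>. \<beta> k = \<alpha> k"
      by auto
  qed (use F in auto)
qed

text \<open>A disagreement at index k alone contributes \<open>1 / 2 ^ k\<close> to the distance,
  which is at least \<open>1 / 2 ^ M\<close>.\<close>

lemma symbol_dist_less_imp_agree:
  assumes "symbol_dist \<alpha> \<beta> < 1 / 2 ^ M" "k \<le> M"
  shows "\<alpha> k = \<beta> k"
proof (rule ccontr)
  assume neq: "\<alpha> k \<noteq> \<beta> k"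
  let ?g = "\<lambda>i. (if \<alpha> i = \<beta> i then 0 else 1) / 2 ^ i :: real"
  have "summable (\<lambda>i. (1/2) ^ i :: real)"
    by (rule summable_geometric) simp
  then have "summable ?g"
    by (rule summable_comparison_test') (auto simp: power_divide)
  then have "(\<Sum>i\<in>{k}. ?g i) \<le> suminf ?g"
    by (intro sum_le_suminf) auto
  then have "1 / 2 ^ k \<le> symbol_dist \<alpha> \<beta>"
    using neq by (simp add: symbol_dist_def)
  moreover have "(1::real) / 2 ^ M \<le> 1 / 2 ^ k"
    using assms(2) by (intro divide_left_mono power_increasing) auto
  ultimately show False using assms(1) by simp
qed

section \<open>The coding maps\<close>

text \<open>The definition of \<open>orbit_map\<close> adds the last map, whereas cylinders are
  unfolded from the first.\<close>

lemma orbit_map_Suc': "orbit_map f n (Suc k) = orbit_map f (Suc n) k \<circ> f n"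
  by (induction k) (auto simp: fun_eq_iff)

lemma cylinder_0: "cylinder f V \<alpha> 0 n = V (\<alpha> 0) n"
  by (simp add: cylinder_def)

text \<open>Splitting off k = 0 shifts the code and the time together. This yields compactness by
  induction and, later, the semiconjugacy.\<close>

lemma cylinder_Suc:
  "cylinder f V \<alpha> (Suc m) n = V (\<alpha> 0) n \<inter> f n -` cylinder f V (shift \<alpha>) m (Suc n)"
proof -
  have "cylinder f V \<alpha> (Suc m) n =
      V (\<alpha> 0) n \<inter> (\<Inter>k\<in>{0..m}. orbit_map f n (Suc k) -` V (\<alpha> (Suc k)) (n + Suc k))"
    unfolding cylinder_def atLeast0_atMost_Suc_eq_insert_0 by (simp del: orbit_map.simps(2) image_Suc_atLeastAtMost)
  then show ?thesis
    unfolding orbit_map_Suc' cylinder_def by (auto simp: shift_def)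
qed

lemma cylinder_antimono: "m \<le> m' \<Longrightarrow> cylinder f V \<alpha> m' n \<subseteq> cylinder f V \<alpha> m n"
  unfolding cylinder_def by (intro INF_superset_mono) auto

lemma cylinder_cong: "(\<And>k. k \<le> m \<Longrightarrow> \<alpha> k = \<beta> k) \<Longrightarrow> cylinder f V \<alpha> m n = cylinder f V \<beta> m n"
  unfolding cylinder_def by (intro INF_cong) auto

section \<open>Cylinders that shrink to points\<close>

locale shrinking_cylinders =
  fixes f :: "nat \<Rightarrow> 'a::metric_space \<Rightarrow> 'a"
    and A :: "real^'s^'s"
    and V :: "'s \<Rightarrow> nat \<Rightarrow> 'a set"
  assumes transition: "transition_matrix A"
    and compact_V: "\<And>i n. compact (V i n)"
    and continuous: "\<And>n. continuous_on (\<Union>k. \<Union>i. V i k) (f n)"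
    and cylinder_nonempty: "\<And>\<alpha> m n. \<alpha> \<in> subshift A \<Longrightarrow> cylinder f V \<alpha> m n \<noteq> {}"
    and diameter_limit: "\<And>\<alpha>. \<alpha> \<in> subshift A \<Longrightarrow>
           uniform_limit UNIV (\<lambda>m n. diameter (cylinder f V \<alpha> m n)) (\<lambda>n. 0) sequentially"
begin

text \<open>The maps are assumed continuous only on the union of the sets V, so the recursion is
  used: each step takes the preimage of a closed set under \<open>f n\<close> restricted to a
  compact set.\<close>

lemma compact_cylinder: "compact (cylinder f V \<alpha> m n)"
proof (induction m arbitrary: \<alpha> n)
  case 0
  show ?case by (simp add: cylinder_0 compact_V)
next
  case (Suc m)
  have "continuous_on (V (\<alpha> 0) n) (f n)"
    by (rule continuous_on_subset[OF continuous]) auto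
  then have "closed (cylinder f V \<alpha> (Suc m) n)"
    unfolding cylinder_Suc
    by (intro continuous_closed_preimage compact_imp_closed compact_V Suc.IH)
  moreover have "cylinder f V \<alpha> (Suc m) n \<subseteq> V (\<alpha> 0) n"
    by (simp add: cylinder_Suc)
  ultimately show ?case
    using compact_V compact_Int_closed by (metis inf.absorb_iff2)
qed

text \<open>Uniform convergence lets one m serve all n. Compactness makes the cylinder bounded, so
  that its diameter bounds distances.\<close>

lemma ex_small_cylinder:
  assumes "\<alpha> \<in> subshift A" "0 < e"
  shows "\<exists>m. \<forall>n. \<forall>x\<in>cylinder f V \<alpha> m n. \<forall>y\<in>cylinder f V \<alpha> m n. dist x y < e"
proof -
  have "\<forall>\<^sub>F m in sequentially. \<forall>n\<in>UNIV. dist (diameter (cylinder f V \<alpha> m n)) 0 < e"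
    using uniform_limitD[OF diameter_limit] assms by blast
  then obtain m where m: "\<And>n. diameter (cylinder f V \<alpha> m n) < e"
    by (auto simp: eventually_sequentially dist_real_def abs_less_iff)
  have "dist x y < e" if "x \<in> cylinder f V \<alpha> m n" "y \<in> cylinder f V \<alpha> m n" for x y n
    using diameter_bounded_bound[OF compact_imp_bounded[OF compact_cylinder] that] m[of n] by linarith
  then show ?thesis by blast
qed

text \<open>For \<alpha> in the subshift exactly one point lies in all cylinders, so the choice is
  determined; for other sequences nothing is claimed.\<close>

definition code_point :: "nat \<Rightarrow> (nat \<Rightarrow> 's) \<Rightarrow> 'a" where
  "code_point n \<alpha> = (SOME x. \<forall>m. x \<in> cylinder f V \<alpha> m n)"

text \<open>Nested nonempty compact sets have a common point: a finite intersection contains the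
  cylinder of largest index.\<close>

lemma code_point_in_cylinder:
  assumes "\<alpha> \<in> subshift A"
  shows "code_point n \<alpha> \<in> cylinder f V \<alpha> m n"
proof -
  have "cylinder f V \<alpha> 0 n \<inter> (\<Inter>m\<in>UNIV. cylinder f V \<alpha> m n) \<noteq> {}"
  proof (rule compact_imp_fip_image)
    fix I :: "nat set" assume "finite I"
    \<comment> \<open>Inserting 0 takes care of the compact factor and keeps \<open>Max\<close>
      meaningful when I is empty.\<close>
    then have "cylinder f V \<alpha> (Max (insert 0 I)) n \<subseteq> cylinder f V \<alpha> m n" if "m \<in> insert 0 I" for m
      using that by (intro cylinder_antimono Max_ge) simp_all
    then have "cylinder f V \<alpha> (Max (insert 0 I)) n \<subseteq> cylinder f V \<alpha> 0 n \<inter> (\<Inter>m\<in>I. cylinder f V \<alpha> m n)"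
      by blast
    then show "cylinder f V \<alpha> 0 n \<inter> (\<Inter>m\<in>I. cylinder f V \<alpha> m n) \<noteq> {}"
      using cylinder_nonempty[OF assms] by blast
  qed (auto intro: compact_cylinder compact_imp_closed)
  then have "\<exists>x. \<forall>m. x \<in> cylinder f V \<alpha> m n"
    by blast
  then show ?thesis
    unfolding code_point_def by (rule someI2_ex) blast
qed

lemma code_point_unique:
  assumes "\<alpha> \<in> subshift A" "\<And>m. x \<in> cylinder f V \<alpha> m n"
  shows "x = code_point n \<alpha>"
proof (rule ccontr)
  assume "x \<noteq> code_point n \<alpha>"
  then have "0 < dist x (code_point n \<alpha>)" by simp
  then show False
    using ex_small_cylinder[OF assms(1)] assms(2) code_point_in_cylinder[OF assms(1)]
    by (metis less_irrefl)
qed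

text \<open>\<open>f n\<close> moves the point into every cylinder of the shifted code, and only one
  point lies in all of these.\<close>

lemma code_point_shift:
  assumes "\<alpha> \<in> subshift A"
  shows "code_point (Suc n) (shift \<alpha>) = f n (code_point n \<alpha>)"
proof -
  have "f n (code_point n \<alpha>) \<in> cylinder f V (shift \<alpha>) m (Suc n)" for m
    using code_point_in_cylinder[OF assms, of n "Suc m"] by (simp add: cylinder_Suc)
  then show ?thesis
    using code_point_unique[OF shift_in_subshift[OF assms]] by metis
qed

lemma orbit_code_point:
  assumes "\<alpha> \<in> subshift A"
  shows "orbit_map f n j (code_point n \<alpha>) = code_point (n + j) ((shift ^^ j) \<alpha>)"
  by (induction j) (simp_all add: code_point_shift funpow_shift_in_subshift[OF assms])

text \<open>A cylinder depends only on a prefix of its code, so codes with the same prefix have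
  their points in one small cylinder. The prefix length depends on \<alpha> but not on n.\<close>

lemma ex_small_prefix:
  assumes "0 < e"
  obtains m where "\<And>\<alpha> \<beta> n. \<alpha> \<in> subshift A \<Longrightarrow> \<beta> \<in> subshift A \<Longrightarrow> (\<And>k. k \<le> m \<alpha> \<Longrightarrow> \<beta> k = \<alpha> k) \<Longrightarrow>
    dist (code_point n \<alpha>) (code_point n \<beta>) < e"
proof -
  obtain m where m: "\<And>\<alpha> n x y. \<alpha> \<in> subshift A \<Longrightarrow> x \<in> cylinder f V \<alpha> (m \<alpha>) n \<Longrightarrow>
      y \<in> cylinder f V \<alpha> (m \<alpha>) n \<Longrightarrow> dist x y < e"
    using ex_small_cylinder[OF _ assms] by metis
  show ?thesis
  proof
    fix \<alpha> \<beta> n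
    assume \<alpha>\<beta>: "\<alpha> \<in> subshift A" "\<beta> \<in> subshift A" and agree: "\<And>k. k \<le> m \<alpha> \<Longrightarrow> \<beta> k = \<alpha> k"
    have "cylinder f V \<beta> (m \<alpha>) n = cylinder f V \<alpha> (m \<alpha>) n"
      by (rule cylinder_cong) (rule agree)
    then have "code_point n \<beta> \<in> cylinder f V \<alpha> (m \<alpha>) n"
      using code_point_in_cylinder[OF \<alpha>\<beta>(2)] by blast
    then show "dist (code_point n \<alpha>) (code_point n \<beta>) < e"
      using m \<alpha>\<beta>(1) code_point_in_cylinder by blast
  qed
qed

text \<open>By compactness finitely many centres suffice. Codes agreeing up to the longest of their
  prefixes share the prefix of one centre, and the triangle inequality with e / 2 applies.\<close>

lemma code_point_equicontinuous:
  assumes "0 < e"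
  obtains M where "\<And>n \<alpha> \<beta>. \<alpha> \<in> subshift A \<Longrightarrow> \<beta> \<in> subshift A \<Longrightarrow> (\<And>k. k \<le> M \<Longrightarrow> \<alpha> k = \<beta> k) \<Longrightarrow>
    dist (code_point n \<alpha>) (code_point n \<beta>) < e"
proof -
  obtain m where m: "\<And>\<alpha> \<beta> n. \<alpha> \<in> subshift A \<Longrightarrow> \<beta> \<in> subshift A \<Longrightarrow> (\<And>k. k \<le> m \<alpha> \<Longrightarrow> \<beta> k = \<alpha> k) \<Longrightarrow>
      dist (code_point n \<alpha>) (code_point n \<beta>) < e / 2"
    using ex_small_prefix[of "e / 2"] assms by auto
  obtain F where F: "finite F" "F \<subseteq> subshift A"
      "\<And>\<beta>. \<beta> \<in> subshift A \<Longrightarrow> \<exists>\<alpha>\<in>F. \<forall>k\<le>m \<alpha>. \<beta> k = \<alpha> k"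
    using finite_subcover_by_prefixes_subshift by blast
  show ?thesis
  proof
    fix n \<alpha> \<beta>
    assume \<alpha>\<beta>: "\<alpha> \<in> subshift A" "\<beta> \<in> subshift A"
      and agree: "\<And>k. k \<le> Max (m ` F) \<Longrightarrow> \<alpha> k = \<beta> k"
    obtain \<gamma> where \<gamma>: "\<gamma> \<in> F" "\<forall>k\<le>m \<gamma>. \<alpha> k = \<gamma> k"
      using F(3)[OF \<alpha>\<beta>(1)] by blast
    then have "m \<gamma> \<le> Max (m ` F)"
      using F(1) by simp
    then have "\<beta> k = \<gamma> k" if "k \<le> m \<gamma>" for k
      using agree[of k] \<gamma>(2) that by simp
    then have "dist (code_point n \<gamma>) (code_point n \<alpha>) < e / 2"
      "dist (code_point n \<gamma>) (code_point n \<beta>) < e / 2"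
      using \<gamma> F(2) \<alpha>\<beta> m[of \<gamma> \<alpha> n] m[of \<gamma> \<beta> n] by auto
    then show "dist (code_point n \<alpha>) (code_point n \<beta>) < e"
      using dist_triangle3[of "code_point n \<alpha>" "code_point n \<beta>" "code_point n \<gamma>"] by linarith
  qed
qed

text \<open>The usual argument for a continuous image of a compact space, with prefixes playing the
  part of neighbourhoods of codes.\<close>

lemma compact_code_points: "compact (code_point n ` subshift A)"
proof (rule compactI)
  fix C :: "'a set set"
  assume C: "\<forall>t\<in>C. open t" "code_point n ` subshift A \<subseteq> \<Union>C"
  \<comment> \<open>The guard makes the claim hold for all sequences, so that choice gives total
    functions m and U.\<close>
  have "\<exists>m U. \<alpha> \<in> subshift A \<longrightarrow> U \<in> C \<and>
      (\<forall>\<beta>\<in>subshift A. (\<forall>k\<le>m. \<beta> k = \<alpha> k) \<longrightarrow> code_point n \<beta> \<in> U)" for \<alpha>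
  proof (cases "\<alpha> \<in> subshift A")
    case True
    then obtain U where U: "U \<in> C" "code_point n \<alpha> \<in> U"
      using C by blast
    then obtain e where e: "0 < e" "ball (code_point n \<alpha>) e \<subseteq> U"
      using C(1) open_contains_ball by metis
    obtain m where "\<And>\<alpha> \<beta> n. \<alpha> \<in> subshift A \<Longrightarrow> \<beta> \<in> subshift A \<Longrightarrow>
        (\<And>k. k \<le> m \<alpha> \<Longrightarrow> \<beta> k = \<alpha> k) \<Longrightarrow> dist (code_point n \<alpha>) (code_point n \<beta>) < e"
      using ex_small_prefix[OF e(1)] by blast
    with True U e show ?thesis
      by (intro exI[of _ "m \<alpha>"] exI[of _ U]) (auto intro!: subsetD[OF e(2)])
  qed auto
  then obtain m U where mU: "\<And>\<alpha>. \<alpha> \<in> subshift A \<Longrightarrow> U \<alpha> \<in> C"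
      "\<And>\<alpha> \<beta>. \<alpha> \<in> subshift A \<Longrightarrow> \<beta> \<in> subshift A \<Longrightarrow> \<forall>k\<le>m \<alpha>. \<beta> k = \<alpha> k \<Longrightarrow> code_point n \<beta> \<in> U \<alpha>"
    by metis
  obtain F where F: "finite F" "F \<subseteq> subshift A"
      "\<And>\<beta>. \<beta> \<in> subshift A \<Longrightarrow> \<exists>\<alpha>\<in>F. \<forall>k\<le>m \<alpha>. \<beta> k = \<alpha> k"
    using finite_subcover_by_prefixes_subshift by blast
  show "\<exists>C'\<subseteq>C. finite C' \<and> code_point n ` subshift A \<subseteq> \<Union>C'"
  proof (intro exI[of _ "U ` F"] conjI)
    show "U ` F \<subseteq> C" "finite (U ` F)"
      using F mU(1) by auto
    show "code_point n ` subshift A \<subseteq> \<Union> (U ` F)"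
    proof clarify
      fix \<beta> assume \<beta>: "\<beta> \<in> subshift A"
      then obtain \<alpha> where "\<alpha> \<in> F" "\<forall>k\<le>m \<alpha>. \<beta> k = \<alpha> k"
        using F(3) by blast
      then show "code_point n \<beta> \<in> \<Union> (U ` F)"
        using mU(2)[of \<alpha> \<beta>] \<beta> F(2) by auto
    qed
  qed
qed

section \<open>The semiconjugacy\<close>

lemma image_code_points: "f n ` code_point n ` subshift A = code_point (Suc n) ` subshift A"
proof -
  have "f n ` code_point n ` subshift A = code_point (Suc n) ` shift ` subshift A"
    unfolding image_image by (intro image_cong) (simp_all add: code_point_shift)
  then show ?thesis
    by (simp add: shift_image_subshift transition)
qed

lemma equi_semiconjugate_code_points: "equi_semiconjugate A f (\<lambda>n. code_point n ` subshift A)"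
proof -
  have "\<exists>\<delta>>0. \<forall>n. \<forall>\<alpha>\<in>subshift A. \<forall>\<beta>\<in>subshift A.
      symbol_dist \<alpha> \<beta> < \<delta> \<longrightarrow> dist (code_point n \<alpha>) (code_point n \<beta>) < e" if e: "0 < e" for e
  proof -
    obtain M where M: "\<And>n \<alpha> \<beta>. \<alpha> \<in> subshift A \<Longrightarrow> \<beta> \<in> subshift A \<Longrightarrow>
        (\<And>k. k \<le> M \<Longrightarrow> \<alpha> k = \<beta> k) \<Longrightarrow> dist (code_point n \<alpha>) (code_point n \<beta>) < e"
      using code_point_equicontinuous[OF e] by blast
    \<comment> \<open>A distance below \<open>1 / 2 ^ M\<close> forces agreement up to index
      M.\<close>
    show ?thesis
      by (intro exI[of _ "1 / 2 ^ M"] conjI allI ballI impI M symbol_dist_less_imp_agree) simp_all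
  qed
  then show ?thesis
    unfolding equi_semiconjugate_def
    by (intro conjI allI exI[of _ code_point])
      (simp_all add: image_code_points code_point_shift)
qed

section \<open>The entropy bound\<close>

text \<open>One set per prefix of n + M + 1 symbols covers. At each time j < n the symbols j to j +
  M of the code fix the orbit point up to e, and they lie inside the prefix.\<close>

lemma min_subcover_code_points_le:
  assumes cover: "\<And>x. \<exists>U\<in>\<A>. ball x e \<subseteq> U"
    and M: "\<And>n \<alpha> \<beta>. \<alpha> \<in> subshift A \<Longrightarrow> \<beta> \<in> subshift A \<Longrightarrow> (\<And>k. k \<le> M \<Longrightarrow> \<alpha> k = \<beta> k) \<Longrightarrow>
      dist (code_point n \<alpha>) (code_point n \<beta>) < e"
  shows "real (min_subcover (restrict_cover (join_cover f \<A> n) (code_point 0 ` subshift A))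
      (code_point 0 ` subshift A)) \<le> entry_sum (matrix_power A (n + M))"
proof -
  let ?Y = "code_point 0 ` subshift A"
  \<comment> \<open>The symbol 0 is kept apart because \<open>words\<close> is indexed by
    it.\<close>
  define prefix where "prefix \<alpha> = (\<alpha> 0, map (shift \<alpha>) [0..<n + M])" for \<alpha> :: "nat \<Rightarrow> 's"
  define rep where "rep = inv_into (subshift A) prefix"
  define P where "P = prefix ` subshift A"
  have rep: "rep (prefix \<alpha>) \<in> subshift A" "prefix (rep (prefix \<alpha>)) = prefix \<alpha>"
    if "\<alpha> \<in> subshift A" for \<alpha>
    using that unfolding rep_def by (simp_all add: inv_into_into f_inv_into_f)
  have prefix_eq: "\<alpha> k = \<beta> k" if eq: "prefix \<alpha> = prefix \<beta>" and "k \<le> n + M" for \<alpha> \<beta> k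
  proof (cases k)
    case 0
    then show ?thesis using eq by (simp add: prefix_def)
  next
    case (Suc l)
    then have "l \<in> set [0..<n + M]" using that by simp
    then have "shift \<alpha> l = shift \<beta> l"
      using eq unfolding prefix_def by (meson Pair_inject map_eq_conv)
    then show ?thesis by (simp add: shift_def Suc)
  qed
  have sub: "P \<subseteq> Sigma UNIV (words A (n + M))"
    by (auto simp: P_def prefix_def map_in_words simp del: upt_Suc)
  have fin: "finite (Sigma UNIV (words A (n + M)))"
    by (simp add: finite_words)
  obtain B where B: "\<And>x. B x \<in> \<A>" "\<And>x. ball x e \<subseteq> B x"
    using cover by metis
  \<comment> \<open>The orbit of the representative code of w selects a cover element at each time
    j.\<close>
  define G where "G w = (\<Inter>j\<in>{..<n}. orbit_map f 0 j -` B (code_point j ((shift ^^ j) (rep w)))) \<inter> ?Y" for w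
  have covers: "?Y \<subseteq> \<Union> (G ` P)"
  proof clarify
    fix \<alpha> assume \<alpha>: "\<alpha> \<in> subshift A"
    let ?\<gamma> = "rep (prefix \<alpha>)"
    have "orbit_map f 0 j (code_point 0 \<alpha>) \<in> B (code_point j ((shift ^^ j) ?\<gamma>))" if "j < n" for j
    proof -
      have "dist (code_point j ((shift ^^ j) ?\<gamma>)) (code_point j ((shift ^^ j) \<alpha>)) < e"
      proof (rule M)
        show "(shift ^^ j) ?\<gamma> k = (shift ^^ j) \<alpha> k" if "k \<le> M" for k
          unfolding funpow_shift using rep[OF \<alpha>] that \<open>j < n\<close> by (intro prefix_eq) auto
      qed (auto intro: funpow_shift_in_subshift rep \<alpha>)
      then have "code_point j ((shift ^^ j) \<alpha>) \<in> ball (code_point j ((shift ^^ j) ?\<gamma>)) e"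
        by simp
      then show ?thesis
        using subsetD[OF B(2)] orbit_code_point[OF \<alpha>, of 0 j] by simp
    qed
    then have "code_point 0 \<alpha> \<in> G (prefix \<alpha>)"
      using \<alpha> by (auto simp: G_def)
    then show "code_point 0 \<alpha> \<in> \<Union> (G ` P)"
      using \<alpha> by (auto simp: P_def)
  qed
  have "G w \<in> restrict_cover (join_cover f \<A> n) ?Y" for w
  proof -
    let ?B = "\<lambda>j. B (code_point j ((shift ^^ j) (rep w)))"
    have "(\<Inter>j\<in>{..<n}. orbit_map f 0 j -` ?B j) \<in> join_cover f \<A> n"
      unfolding join_cover_def using B(1) by (intro CollectI exI[of _ ?B]) simp
    then show ?thesis
      unfolding restrict_cover_def G_def by (intro CollectI exI conjI) (rule refl)
  qed
  then have G: "G ` P \<subseteq> restrict_cover (join_cover f \<A> n) ?Y"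
    by (rule image_subsetI)
  have "min_subcover (restrict_cover (join_cover f \<A> n) ?Y) ?Y \<le> card (G ` P)"
    unfolding min_subcover_def
    using G covers finite_subset[OF sub fin]
    by (intro Least_le exI[of _ "G ` P"] conjI finite_imageI refl)
  also have "\<dots> \<le> card P"
    by (intro card_image_le finite_subset[OF sub fin])
  also have "\<dots> \<le> card (Sigma UNIV (words A (n + M)))"
    by (rule card_mono[OF fin sub])
  also have "\<dots> = (\<Sum>i\<in>UNIV. card (words A (n + M) i))"
    by (simp add: finite_words)
  finally have "real (min_subcover (restrict_cover (join_cover f \<A> n) ?Y) ?Y)
      \<le> (\<Sum>i\<in>UNIV. real (card (words A (n + M) i)))"
    by (metis of_nat_le_iff of_nat_sum)
  also have "\<dots> \<le> entry_sum (matrix_power A (n + M))"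
    unfolding entry_sum_def
    by (intro sum_mono card_words_le transition_matrixD(1)[OF transition])
  finally show ?thesis .
qed

text \<open>With e a Lebesgue number of the cover, equicontinuity gives M, and a fixed delay M does
  not change the exponential rate.\<close>

lemma entropy_on_code_points_le:
  assumes "compact (UNIV :: 'a set)"
  shows "entropy_on f (code_point 0 ` subshift A) \<le> ereal (ln (matrix_growth A))"
  unfolding entropy_on_def
proof (rule SUP_least, clarify)
  fix \<A> :: "'a set set"
  assume \<A>: "\<forall>U\<in>\<A>. open U" "\<Union> \<A> = UNIV"
  let ?Y = "code_point 0 ` subshift A"
  let ?N = "\<lambda>n. min_subcover (restrict_cover (join_cover f \<A> n) ?Y) ?Y"
  let ?a = "\<lambda>n. entry_sum (matrix_power A n)"
  obtain e where e: "0 < e" "\<And>x. \<exists>U\<in>\<A>. ball x e \<subseteq> U"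
    using Heine_Borel_lemma[OF assms, of \<A>] \<A> by auto
  obtain M where M: "\<And>n \<alpha> \<beta>. \<alpha> \<in> subshift A \<Longrightarrow> \<beta> \<in> subshift A \<Longrightarrow>
      (\<And>k. k \<le> M \<Longrightarrow> \<alpha> k = \<beta> k) \<Longrightarrow> dist (code_point n \<alpha>) (code_point n \<beta>) < e"
    using code_point_equicontinuous[OF e(1)] by blast
  have le: "ln (real (?N n)) / real n \<le> ln (?a (n + M)) / real n" for n
  proof -
    have "real (?N n) \<le> ?a (n + M)"
      by (rule min_subcover_code_points_le[OF e(2) M])
    \<comment> \<open>The case \<open>?N n = 0\<close> does not occur; \<open>ln 0 = 0\<close> covers it.\<close>
    then have "ln (real (?N n)) \<le> ln (?a (n + M))"
      using entry_sum_matrix_power_ge_1[OF transition, of "n + M"] by (cases "?N n = 0") auto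
    then show ?thesis by (rule divide_right_mono) simp
  qed
  \<comment> \<open>The second factor is (n + M) / n; it changes the denominator from n + M to n and
    tends to 1.\<close>
  have "(\<lambda>n. ln (?a (n + M)) / real (n + M) * (1 + real M / real n)) \<longlonglongrightarrow> ln (matrix_growth A) * (1 + 0)"
    by (intro tendsto_mult tendsto_add tendsto_const lim_const_over_n
        LIMSEQ_ignore_initial_segment[OF ln_entry_sum_tendsto[OF transition]])
  moreover have "\<forall>\<^sub>F n in sequentially.
      ln (?a (n + M)) / real (n + M) * (1 + real M / real n) = ln (?a (n + M)) / real n"
    using eventually_gt_at_top[of 0]
  proof eventually_elim
    case (elim n)
    then have "1 + real M / real n = real (n + M) / real n"
      by (simp add: add_divide_distrib)
    with elim show ?case by simp
  qed
  ultimately have "(\<lambda>n. ln (?a (n + M)) / real n) \<longlonglongrightarrow> ln (matrix_growth A) * (1 + 0)"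
    by (rule Lim_transform_eventually)
  then have "limsup (\<lambda>n. ereal (ln (?a (n + M)) / real n)) = ereal (ln (matrix_growth A))"
    by (intro lim_imp_Limsup) simp_all
  moreover have "limsup (\<lambda>n. ereal (ln (real (?N n)) / real n)) \<le> limsup (\<lambda>n. ereal (ln (?a (n + M)) / real n))"
    by (intro Limsup_mono always_eventually) (simp add: le)
  ultimately show "limsup (\<lambda>n. ereal (ln (real (?N n)) / real n)) \<le> ereal (ln (matrix_growth A))"
    by simp
qed

end

theorem theorem3p5:
  fixes f :: "nat \<Rightarrow> 'a::metric_space \<Rightarrow> 'a"
    and A :: "real^'s^'s"
    and V :: "'s \<Rightarrow> nat \<Rightarrow> 'a set"
  assumes "transition_matrix A"
    and "\<And>i n. V i n \<noteq> {}"
    and "\<And>i n. compact (V i n)"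
    and "\<And>n. continuous_on (\<Union>k. \<Union>i. V i k) (f n)"
    and "\<And>\<alpha> m n. \<alpha> \<in> subshift A \<Longrightarrow> cylinder f V \<alpha> m n \<noteq> {}"
    and "\<And>\<alpha>. \<alpha> \<in> subshift A \<Longrightarrow>
           uniform_limit UNIV (\<lambda>m n. diameter (cylinder f V \<alpha> m n)) (\<lambda>n. 0) sequentially"
  shows "\<exists>\<Lambda> :: nat \<Rightarrow> 'a set.
           (\<forall>n. \<Lambda> n \<noteq> {} \<and> compact (\<Lambda> n) \<and> \<Lambda> n \<subseteq> (\<Union>i. V i n) \<and> f n ` \<Lambda> n = \<Lambda> (Suc n)) \<and>
           equi_semiconjugate A f \<Lambda> \<and>
           (compact (UNIV :: 'a set) \<longrightarrow> entropy_on f (\<Lambda> 0) \<le> ereal (ln (matrix_growth A)))"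
proof -
  interpret shrinking_cylinders f A V
    by unfold_locales (fact assms)+
  show ?thesis
  proof (intro exI[of _ "\<lambda>n. code_point n ` subshift A"] conjI allI impI)
    fix n
    show "code_point n ` subshift A \<noteq> {}"
      using subshift_nonempty[OF transition] by simp
    show "compact (code_point n ` subshift A)"
      by (rule compact_code_points)
    show "code_point n ` subshift A \<subseteq> (\<Union>i. V i n)"
      using code_point_in_cylinder[of _ n 0] by (auto simp: cylinder_0)
    show "f n ` code_point n ` subshift A = code_point (Suc n) ` subshift A"
      by (rule image_code_points)
  qed (fact equi_semiconjugate_code_points, rule entropy_on_code_points_le)
qed

end
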